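(* Let $G=(V,E)$ be a finite connected graph, and let $\Psi\le\mathrm{Aut}(G)$ be a group of automorphisms with edge orbits $\mathcal{O}_1,\dots,\mathcal{O}_s$; put $\mathcal{O}=(|\mathcal{O}_1|,\dots,|\mathcal{O}_s|)\in\mathbb{R}^s$. Then $G$ is lower conformally rigid if and only if there exist finitely many unit-length eigenvectors $\varphi_1,\dots,\varphi_r\in\mathcal{E}_{\lambda_2}$ and coefficients $a_i\ge 0$ with $\sum_{i=1}^r a_i=1$ such that $$c\,\mathcal{O}=\sum_{i=1}^r a_i\,\ell_\Psi(\varphi_i)$$ for some constant $c>0$. Likewise, $G$ is upper conformally rigid if and only if the same holds with $\mathcal{E}_{\lambda_n}$ in place of $\mathcal{E}_{\lambda_2}$.
   Context: $G=(V,E)$ is a finite, connected, simple undirected graph with $n=|V|\ge 2$ vertices. For edge weights $w:E\to\mathbb{R}$, $w\ge 0$, the weighted Laplacian $L(w)$ is the symmetric matrix with quadratic form $\langle\varphi,L(w)\varphi\rangle=\sum_{uv\in E}w_{uv}(\varphi(u)-\varphi(v))^2$ for $\varphi\in\mathbb{R}^V$, and its eigenvalues are $0=\lambda_1(w)\le\lambda_2(w)\le\cdots\le\lambda_n(w)$. Write $\mathbf{1}$ for the all-ones vector, $L=L(\mathbf{1})$, $\lambda_k=\lambda_k(\mathbf{1})$, and $\mathcal{E}_\lambda=\{\varphi\in\mathbb{R}^V: L\varphi=\lambda\varphi\}$. $G$ is lower conformally rigid if $\lambda_2(w)\le\lambda_2$ for all $w\ge 0$ with $\sum_{uv\in E}w_{uv}=|E|$;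 $G$ is upper conformally rigid if $\lambda_n(w)\ge\lambda_n$ for all $w\ge 0$ with $\sum_{uv\in E}w_{uv}=|E|$. The edge orbits of $\Psi$ are the orbits of its natural action on the (unordered) edge set $E$. For $\varphi:V\to\mathbb{R}$, the orbit-energy vector is $\ell_\Psi(\varphi)=\big(\sum_{uv\in\mathcal{O}_i}(\varphi(u)-\varphi(v))^2\big)_{i=1}^s\in\mathbb{R}^s$. *)

theory Defs
  imports
    "HOL-Analysis.Analysis"
    "HOL-Algebra.Group_Action"
    "HOL-Library.Multiset"
begin

text \<open>
  The vertex set is a finite type, so that \<open>\<real>\<^sup>V\<close> is \<open>real^'v\<close>. Edges are two-element vertex
  sets, and edge weights are functions on vertex sets of which only the values on the edges matter.
\<close>

definition simple_graph :: "'v set set \<Rightarrow> bool" where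
  "simple_graph E \<longleftrightarrow> (\<forall>e\<in>E. card e = 2)"

definition connected_graph :: "'v set set \<Rightarrow> bool" where
  "connected_graph E \<longleftrightarrow> (\<forall>u v. (u, v) \<in> {(x, y). {x, y} \<in> E}\<^sup>*)"

definition edge_energy :: "real^'v \<Rightarrow> 'v set \<Rightarrow> real" where
  "edge_energy \<phi> e = (THE x. \<exists>u v. e = {u, v} \<and> x = (\<phi> $ u - \<phi> $ v)\<^sup>2)"

lemma edge_energy_pair [simp]: "edge_energy \<phi> {u, v} = (\<phi> $ u - \<phi> $ v)\<^sup>2"
  unfolding edge_energy_def
  by (rule the_equality) (auto simp: doubleton_eq_iff power2_commute)

definition laplacian :: "'v::finite set set \<Rightarrow> ('v set \<Rightarrow> real) \<Rightarrow> real^'v^'v" where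
  "laplacian E w = (\<chi> u v. if u = v then \<Sum>e\<in>{e\<in>E. u \<in> e}. w e
                           else if {u, v} \<in> E then - w {u, v} else 0)"

text \<open>
  The next two lemmas characterise the matrix: it is the symmetric matrix whose quadratic form is
  the weighted Dirichlet energy.
\<close>

lemma transpose_laplacian: "transpose (laplacian E w) = laplacian E w"
  by (auto simp: laplacian_def transpose_def vec_eq_iff insert_commute)

lemma laplacian_quadratic_form:
  fixes E :: "'v::finite set set"
  assumes "simple_graph E"
  shows "\<phi> \<bullet> (laplacian E w *v \<phi>) = (\<Sum>e\<in>E. w e * edge_energy \<phi> e)"
proof -
  define B :: "'v set \<Rightarrow> 'v \<Rightarrow> 'v \<Rightarrow> real" where
    "B e u v = (if u = v then of_bool (u \<in> e) else - of_bool (e = {u, v}))" for e u v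
  have entry: "laplacian E w $ u $ v = (\<Sum>e\<in>E. w e * B e u v)" for u v
  proof (cases "u = v")
    case True
    have "(\<Sum>e\<in>E. w e * B e u u) = (\<Sum>e\<in>{e\<in>E. u \<in> e}. w e)"
      by (intro sum.mono_neutral_cong_right) (auto simp: B_def)
    with True show ?thesis by (simp add: laplacian_def)
  next
    case False
    have "(\<Sum>e\<in>E. w e * B e u v) = (\<Sum>e\<in>E. if e = {u, v} then - w {u, v} else 0)"
      using False by (intro sum.cong) (auto simp: B_def)
    with False show ?thesis by (simp add: laplacian_def)
  qed
  have edge: "(\<Sum>u\<in>UNIV. \<Sum>v\<in>UNIV. \<phi> $ u * (B e u v * \<phi> $ v)) = edge_energy \<phi> e"
    if "e \<in> E" for e
  proof -
    from that assms obtain a b where e: "e = {a, b}" "a \<noteq> b"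
      by (auto simp: simple_graph_def card_2_iff)
    have inner: "(\<Sum>v\<in>UNIV. \<phi> $ u * (B e u v * \<phi> $ v)) =
        (if u = a then \<phi> $ a * (\<phi> $ a - \<phi> $ b) else 0) +
        (if u = b then \<phi> $ b * (\<phi> $ b - \<phi> $ a) else 0)" for u
    proof -
      have "(\<Sum>v\<in>UNIV. \<phi> $ u * (B e u v * \<phi> $ v)) = (\<Sum>v\<in>{a, b}. \<phi> $ u * (B e u v * \<phi> $ v))"
        using e by (intro sum.mono_neutral_right) (auto simp: B_def doubleton_eq_iff)
      also have "\<dots> = \<phi> $ u * (B e u a * \<phi> $ a) + \<phi> $ u * (B e u b * \<phi> $ b)"
        using e by simp
      finally show ?thesis
        using e by (auto simp: B_def doubleton_eq_iff algebra_simps)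
    qed
    show ?thesis
      unfolding inner sum.distrib using e
      by (simp add: power2_eq_square algebra_simps)
  qed
  have "\<phi> \<bullet> (laplacian E w *v \<phi>) =
      (\<Sum>u\<in>UNIV. \<Sum>v\<in>UNIV. \<Sum>e\<in>E. w e * (\<phi> $ u * (B e u v * \<phi> $ v)))"
    by (simp add: inner_vec_def matrix_vector_mult_def entry sum_distrib_left sum_distrib_right
        mult_ac)
  also have "\<dots> = (\<Sum>u\<in>UNIV. \<Sum>e\<in>E. \<Sum>v\<in>UNIV. w e * (\<phi> $ u * (B e u v * \<phi> $ v)))"
    by (intro sum.cong refl sum.swap)
  also have "\<dots> = (\<Sum>e\<in>E. \<Sum>u\<in>UNIV. \<Sum>v\<in>UNIV. w e * (\<phi> $ u * (B e u v * \<phi> $ v)))"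
    by (rule sum.swap)
  also have "\<dots> = (\<Sum>e\<in>E. w e * edge_energy \<phi> e)"
    by (intro sum.cong refl) (simp add: edge [symmetric] sum_distrib_left)
  finally show ?thesis .
qed

definition eigenspace :: "real^'n^'n \<Rightarrow> real \<Rightarrow> (real^'n) set" where
  "eigenspace A \<mu> = {x. A *v x = \<mu> *\<^sub>R x}"

text \<open>
  Each eigenvalue is repeated according to the dimension of its eigenspace. This is used only for
  symmetric matrices, where geometric and algebraic multiplicities agree.
\<close>

definition eigenvalue_list :: "real^'n^'n \<Rightarrow> real list" where
  "eigenvalue_list A = sorted_list_of_multiset
     (\<Sum>\<mu>\<in>{\<mu>. eigenspace A \<mu> \<noteq> {0}}. replicate_mset (dim (eigenspace A \<mu>)) \<mu>)"

text \<open>\<open>lap_eigenvalue E w k\<close> is \<open>\<lambda>\<^sub>k(w)\<close>, counted from \<open>k = 1\<close>.\<close>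

definition lap_eigenvalue :: "'v::finite set set \<Rightarrow> ('v set \<Rightarrow> real) \<Rightarrow> nat \<Rightarrow> real" where
  "lap_eigenvalue E w k = eigenvalue_list (laplacian E w) ! (k - 1)"

definition normalized_weight :: "'v set set \<Rightarrow> ('v set \<Rightarrow> real) \<Rightarrow> bool" where
  "normalized_weight E w \<longleftrightarrow> (\<forall>e\<in>E. 0 \<le> w e) \<and> (\<Sum>e\<in>E. w e) = real (card E)"

definition lower_conformally_rigid :: "'v::finite set set \<Rightarrow> bool" where
  "lower_conformally_rigid E \<longleftrightarrow>
     (\<forall>w. normalized_weight E w \<longrightarrow> lap_eigenvalue E w 2 \<le> lap_eigenvalue E (\<lambda>_. 1) 2)"

definition upper_conformally_rigid :: "'v::finite set set \<Rightarrow> bool" where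
  "upper_conformally_rigid E \<longleftrightarrow>
     (\<forall>w. normalized_weight E w \<longrightarrow>
        lap_eigenvalue E w CARD('v) \<ge> lap_eigenvalue E (\<lambda>_. 1) CARD('v))"

definition Aut_group :: "'v set set \<Rightarrow> ('v \<Rightarrow> 'v) monoid" where
  "Aut_group E = BijGroup UNIV
     \<lparr>carrier := {g. bij g \<and> (\<forall>u v. {u, v} \<in> E \<longleftrightarrow> {g u, g v} \<in> E)}\<rparr>"

definition edge_orbits :: "'v set set \<Rightarrow> ('v \<Rightarrow> 'v) set \<Rightarrow> 'v set set set" where
  "edge_orbits E \<Psi> = orbits (Aut_group E\<lparr>carrier := \<Psi>\<rparr>) E (\<lambda>g. \<lambda>e\<in>E. g ` e)"

definition orbit_energy :: "(nat \<Rightarrow> 'v set set) \<Rightarrow> real^'v \<Rightarrow> nat \<Rightarrow> real" where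
  "orbit_energy Os \<phi> j = (\<Sum>e\<in>Os j. edge_energy \<phi> e)"

end

theory Submission
  imports Defs
begin

text \<open>
  Both equivalences are the same statement about a linear family of continuous functions on a
  compact set. The Dirichlet form \<open>D w \<phi> = (\<Sum>e. w e * edge_energy \<phi> e)\<close> is linear in \<open>w\<close>, and
  \<open>\<lambda>\<^sub>2(w)\<close> is its minimum over the unit vectors orthogonal to the constants, while \<open>\<lambda>\<^sub>n(w)\<close> is its
  maximum over all unit vectors. With \<open>S\<close> the set of test vectors and a sign \<open>\<sigma>\<close> that turns the maximum
  into a minimum, rigidity says that no normalized \<open>w\<close> makes the minimum of \<open>\<sigma> * D w\<close> over \<open>S\<close> larger
  than its value \<open>m\<close> at \<open>w = 1\<close>, and the unit eigenvectors are exactly the minimizers at \<open>w = 1\<close>.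

  Rigidity gives the balance condition by convex separation
  (\<open>extremal_rigidity_imp_edge_balance\<close>). The edge energies of each minimizer sum to \<open>\<sigma> * m\<close>. If no
  convex combination of the edge energy vectors of minimizers is constant on \<open>E\<close>, a hyperplane
  separates the constant vector from their convex hull; its normal vector, shifted to have coordinate
  sum 0, is a direction in which every minimizer increases to first order. A small step from the
  weight 1 in this direction then increases the minimum itself (\<open>strict_minimum_perturbation\<close>),
  contrary to rigidity. So some convex combination of energy vectors is constant on the edges, and
  summing over orbits gives the stated identity.

  Conversely, a combination that is only balanced on orbits becomes balanced on every edge once each
  eigenvector is replaced by all its translates under \<open>\<Psi>\<close>: the averaged energy is constant on each
  orbit, and its mean there is \<open>c\<close> (\<open>orbit_balance_imp_edge_balance\<close>). The translates are test vectors
  too, and the weighted mean of their values \<open>\<sigma> * D w\<close> is \<open>\<sigma> * c * card E = m\<close> for every normalized \<open>w\<close>,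
  so one of these values is at most \<open>m\<close>.

  The two variational formulas rest on the fact that the dimensions of the eigenspaces of a symmetric
  matrix add up to the size of the matrix (\<open>spectral_dimension\<close>), which makes the positions in the
  sorted list of eigenvalues meaningful. Connectedness gives \<open>\<lambda>\<^sub>2 > 0\<close>, which makes
  the \<open>\<lambda>\<^sub>2\<close>-eigenvectors orthogonal to the constants and the constant \<open>c\<close> positive.
\<close>

section \<open>Eigenvectors as extremal points of quadratic forms\<close>

text \<open>
  Near \<open>t = 0\<close> the linear term dominates, so a nonzero \<open>b\<close> would make the expression negative on one
  side.
\<close>

lemma linear_coefficient_zero:
  fixes b c :: real
  assumes "\<And>t. 0 \<le> 2 * t * b + t\<^sup>2 * c"
  shows "b = 0"
proof (rule ccontr)
  assume b: "b \<noteq> 0"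
  (* at t = - b * s the linear term is - 2 * b^2 * s;
     s * c < 1 keeps the quadratic one below b^2 * s *)
  define s where "s = 1 / (\<bar>c\<bar> + 1)"
  have s: "s > 0" "s * c < 1"
    by (auto simp: s_def field_simps abs_if)
  have "0 \<le> 2 * (- b * s) * b + (- b * s)\<^sup>2 * c"
    by (rule assms)
  also have "\<dots> = b\<^sup>2 * s * (s * c - 2)"
    by (simp add: power2_eq_square algebra_simps)
  also have "\<dots> < 0"
    using b s by (intro mult_pos_neg) auto
  finally show False by simp
qed

lemma transpose_minus:
  fixes A :: "real^'n^'m"
  shows "transpose (- A) = - transpose A"
  by (simp add: transpose_def vec_eq_iff)

lemma minus_matrix_vector_mult:
  fixes A :: "real^'n^'m"
  shows "- A *v y = - (A *v y)"
  by (simp add: vec_eq_iff matrix_vector_mult_def sum_negf)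

lemma symmetric_matrix_inner:
  fixes A :: "real^'n^'n"
  assumes "transpose A = A"
  shows "x \<bullet> (A *v y) = (A *v x) \<bullet> y"
  by (metis assms dot_lmul_matrix transpose_matrix_vector)

text \<open>
  The first-order condition at a minimizer: \<open>y \<bullet> (A *v y) - m * (y \<bullet> y)\<close> is nonnegative on \<open>U\<close> and vanishes
  at \<open>x\<close>, so its derivative at \<open>x\<close> in the direction of the residual \<open>A *v x - m *\<^sub>R x\<close> is zero. That
  derivative is twice the squared length of the residual. The homogeneous form avoids a constraint
  to the unit sphere.
\<close>

lemma rayleigh_minimizer_in_eigenspace:
  fixes A :: "real^'n^'n"
  assumes sym: "transpose A = A" and U: "subspace U" and inv: "\<And>y. y \<in> U \<Longrightarrow> A *v y \<in> U"
    and lower: "\<And>y. y \<in> U \<Longrightarrow> m * (y \<bullet> y) \<le> y \<bullet> (A *v y)"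
    and x: "x \<in> U" "x \<bullet> (A *v x) = m * (x \<bullet> x)"
  shows "x \<in> eigenspace A m"
proof -
  define z where "z = A *v x - m *\<^sub>R x"
  have z: "z \<in> U"
    unfolding z_def using U inv x(1) by (intro subspace_diff subspace_scale) auto
  have "z \<bullet> z = 0"
  proof (rule linear_coefficient_zero)
    fix t :: real
    have "x + t *\<^sub>R z \<in> U"
      using U x(1) z by (intro subspace_add subspace_scale) auto
    from lower[OF this]
    have "0 \<le> (x + t *\<^sub>R z) \<bullet> (A *v (x + t *\<^sub>R z)) - m * ((x + t *\<^sub>R z) \<bullet> (x + t *\<^sub>R z))"
      by simp
    also have "\<dots> = 2 * t * (z \<bullet> (A *v x) - m * (z \<bullet> x)) + t\<^sup>2 * (z \<bullet> (A *v z) - m * (z \<bullet> z))"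
      using x(2) symmetric_matrix_inner[OF sym, of x z]
      by (simp add: matrix_vector_right_distrib matrix_vector_mult_scaleR inner_add_left
          inner_add_right inner_commute power2_eq_square algebra_simps)
    also have "z \<bullet> (A *v x) - m * (z \<bullet> x) = z \<bullet> z"
      by (simp add: z_def inner_diff_right)
    finally show "0 \<le> 2 * t * (z \<bullet> z) + t\<^sup>2 * (z \<bullet> (A *v z) - m * (z \<bullet> z))" .
  qed
  then show ?thesis by (simp add: z_def eigenspace_def)
qed

lemma unit_lower_bound_homogeneous:
  fixes A :: "real^'n^'n"
  assumes U: "subspace U" and "y \<in> U"
    and lower: "\<And>y. y \<in> U \<Longrightarrow> norm y = 1 \<Longrightarrow> m \<le> y \<bullet> (A *v y)"
  shows "m * (y \<bullet> y) \<le> y \<bullet> (A *v y)"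
proof (cases "y = 0")
  case False
  define z where "z = (1 / norm y) *\<^sub>R y"
  have yz: "y = norm y *\<^sub>R z" and z: "norm z = 1" "z \<in> U"
    using False assms by (auto simp: z_def subspace_scale)
  have "m * (norm y)\<^sup>2 \<le> (z \<bullet> (A *v z)) * (norm y)\<^sup>2"
    using lower[OF z(2,1)] by (intro mult_right_mono) auto
  also have "\<dots> = (norm y *\<^sub>R z) \<bullet> (A *v (norm y *\<^sub>R z))"
    by (simp add: matrix_vector_mult_scaleR power2_eq_square)
  finally show ?thesis
    using yz by (simp add: dot_square_norm)
qed simp

lemma subspace_has_unit_vector:
  fixes S :: "'a::real_normed_vector set"
  assumes "subspace S" "x \<in> S" "x \<noteq> 0"
  shows "\<exists>y\<in>S. norm y = 1"
proof (rule bexI)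
  show "(1 / norm x) *\<^sub>R x \<in> S" by (rule subspace_scale[OF assms(1,2)])
  show "norm ((1 / norm x) *\<^sub>R x) = 1" using assms(3) by simp
qed

lemma exists_rayleigh_minimizer:
  fixes A :: "real^'n^'n"
  assumes U: "subspace U" "U \<noteq> {0}"
  obtains x where "x \<in> U" "norm x = 1"
    "\<And>y. y \<in> U \<Longrightarrow> norm y = 1 \<Longrightarrow> x \<bullet> (A *v x) \<le> y \<bullet> (A *v y)"
proof -
  obtain y where y: "y \<in> U" "y \<noteq> 0"
    using U subspace_0 by blast
  then have ne: "U \<inter> sphere 0 1 \<noteq> {}"
    using subspace_has_unit_vector[OF U(1)] by fastforce
  have "compact (U \<inter> sphere 0 1)"
    using closed_subspace[OF U(1)] by (intro closed_Int_compact) auto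
  moreover have "continuous_on (U \<inter> sphere 0 1) (\<lambda>x. x \<bullet> (A *v x))"
    by (intro continuous_intros matrix_vector_mult_linear_continuous_on)
  ultimately obtain x where "x \<in> U \<inter> sphere 0 1"
    "\<forall>y\<in>U \<inter> sphere 0 1. x \<bullet> (A *v x) \<le> y \<bullet> (A *v y)"
    using ne continuous_attains_inf[of "U \<inter> sphere 0 1" "\<lambda>x. x \<bullet> (A *v x)"] by blast
  then show ?thesis by (intro that[of x]) auto
qed

lemma exists_minimal_eigenvector:
  fixes A :: "real^'n^'n"
  assumes sym: "transpose A = A" and U: "subspace U" "U \<noteq> {0}"
    and inv: "\<And>y. y \<in> U \<Longrightarrow> A *v y \<in> U"
  obtains x m where "x \<in> U" "norm x = 1" "x \<in> eigenspace A m"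
    "\<And>y. y \<in> U \<Longrightarrow> norm y = 1 \<Longrightarrow> m \<le> y \<bullet> (A *v y)"
proof -
  obtain x where x: "x \<in> U" "norm x = 1"
    "\<And>y. y \<in> U \<Longrightarrow> norm y = 1 \<Longrightarrow> x \<bullet> (A *v x) \<le> y \<bullet> (A *v y)"
    using exists_rayleigh_minimizer[OF U] by metis
  have "x \<in> eigenspace A (x \<bullet> (A *v x))"
    using x by (intro rayleigh_minimizer_in_eigenspace[OF sym U(1) inv]
        unit_lower_bound_homogeneous[OF U(1)]) (auto simp: dot_square_norm)
  with x that show ?thesis by blast
qed

section \<open>The spectrum with multiplicities\<close>

lemma subspace_eigenspace: "subspace (eigenspace A \<mu>)"
proof (rule subspaceI)
  show "0 \<in> eigenspace A \<mu>" by (simp add: eigenspace_def)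
  show "x + y \<in> eigenspace A \<mu>" if "x \<in> eigenspace A \<mu>" "y \<in> eigenspace A \<mu>" for x y
    using that by (simp add: eigenspace_def matrix_vector_right_distrib scaleR_right_distrib)
  show "c *\<^sub>R x \<in> eigenspace A \<mu>" if "x \<in> eigenspace A \<mu>" for c x
    using that by (simp add: eigenspace_def matrix_vector_mult_scaleR)
qed

lemma eigenspaces_orthogonal:
  fixes A :: "real^'n^'n"
  assumes "transpose A = A" "x \<in> eigenspace A \<mu>" "y \<in> eigenspace A \<nu>" "\<mu> \<noteq> \<nu>"
  shows "x \<bullet> y = 0"
proof -
  have "\<nu> * (x \<bullet> y) = \<mu> * (x \<bullet> y)"
    using symmetric_matrix_inner[OF assms(1), of x y] assms(2,3)
    by (simp add: eigenspace_def)
  with assms(4) show ?thesis by simp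
qed

text \<open>
  The finite-dimensional spectral theorem. The union \<open>C\<close> of orthonormal bases of all eigenspaces is
  orthogonal, hence independent, hence finite. If it did not span, its orthogonal complement would be
  a nonzero invariant subspace, which contains an eigenvector by minimization of the quadratic form;
  but that eigenvector also lies in the span of \<open>C\<close>.
\<close>

lemma spectral_dimension:
  fixes A :: "real^'n^'n"
  assumes sym: "transpose A = A"
  defines "\<Lambda> \<equiv> {\<mu>. eigenspace A \<mu> \<noteq> {0}}"
  shows "finite \<Lambda>" "(\<Sum>\<mu>\<in>\<Lambda>. dim (eigenspace A \<mu>)) = CARD('n)"
proof -
  have "\<exists>B. B \<subseteq> eigenspace A \<mu> \<and> pairwise orthogonal B \<and> 0 \<notin> B \<and>
      card B = dim (eigenspace A \<mu>) \<and> span B = eigenspace A \<mu>" for \<mu>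
    by (rule orthonormal_basis_subspace[OF subspace_eigenspace[of A \<mu>]])
      (metis norm_zero zero_neq_one)
  then obtain B where B: "\<And>\<mu>. B \<mu> \<subseteq> eigenspace A \<mu>" "\<And>\<mu>. pairwise orthogonal (B \<mu>)"
    "\<And>\<mu>. 0 \<notin> B \<mu>" "\<And>\<mu>. card (B \<mu>) = dim (eigenspace A \<mu>)" "\<And>\<mu>. span (B \<mu>) = eigenspace A \<mu>"
    by metis
  define C where "C = (\<Union>\<mu>\<in>\<Lambda>. B \<mu>)"
  have orth: "orthogonal x y" if "x \<in> B \<mu>" "y \<in> B \<nu>" "\<mu> \<noteq> \<nu>" for x y \<mu> \<nu>
    using that B(1) eigenspaces_orthogonal[OF sym] unfolding orthogonal_def by blast
  have disj: "B \<mu> \<inter> B \<nu> = {}" if "\<mu> \<noteq> \<nu>" for \<mu> \<nu>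
    using orth[OF _ _ that] B(3) orthogonal_self by (metis disjoint_iff)
  have "pairwise orthogonal C"
    unfolding C_def pairwise_def using orth B(2) by (auto simp: pairwise_def) metis
  then have ind: "independent C"
    using B(3) by (intro pairwise_orthogonal_independent) (auto simp: C_def)
  then have fin: "finite C"
    by (rule independent_imp_finite)
  have ne: "\<exists>x. x \<in> B \<mu>" if "\<mu> \<in> \<Lambda>" for \<mu>
    using that B(5)[of \<mu>] unfolding \<Lambda>_def by (metis (mono_tags) ex_in_conv mem_Collect_eq span_empty)
  define f where "f \<mu> = (SOME x. x \<in> B \<mu>)" for \<mu>
  have f: "f \<mu> \<in> B \<mu>" if "\<mu> \<in> \<Lambda>" for \<mu>
    unfolding f_def using ne[OF that] by (rule someI_ex)
  have "inj_on f \<Lambda>"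
    using f disj by (metis disjoint_iff inj_onI)
  moreover have "f ` \<Lambda> \<subseteq> C"
    using f by (auto simp: C_def)
  ultimately show fin\<Lambda>: "finite \<Lambda>"
    using fin finite_imageD finite_subset by blast
  have "span C = UNIV"
  proof (rule ccontr)
    assume "span C \<noteq> UNIV"
    then obtain a where a: "a \<noteq> 0" "span C \<subseteq> {x. a \<bullet> x = 0}"
      using span_not_UNIV_orthogonal[of C] by blast
    define W where "W = {x. \<forall>c\<in>C. c \<bullet> x = 0}"
    have "a \<in> W"
      using a(2) span_superset[of C] by (auto simp: W_def inner_commute)
    with a(1) have "W \<noteq> {0}" by blast
    moreover have "subspace W"
      by (auto simp: W_def subspace_def inner_add_right)
    moreover have "A *v x \<in> W" if "x \<in> W" for x
    proof -
      have "c \<bullet> (A *v x) = 0" if c: "c \<in> C" for c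
      proof -
        obtain \<mu> where "c \<in> eigenspace A \<mu>"
          using c B(1) by (auto simp: C_def)
        then show ?thesis
          using \<open>x \<in> W\<close> c symmetric_matrix_inner[OF sym, of c x]
          by (simp add: eigenspace_def W_def)
      qed
      then show ?thesis by (simp add: W_def)
    qed
    ultimately obtain x m where x: "x \<in> W" "norm x = 1" "x \<in> eigenspace A m"
      using exists_minimal_eigenvector[OF sym, of W] by metis
    have "x \<noteq> 0" using x(2) by auto
    with x(3) have "m \<in> \<Lambda>" by (auto simp: \<Lambda>_def)
    with x(1) have "\<And>c. c \<in> B m \<Longrightarrow> orthogonal x c"
      by (auto simp: W_def C_def orthogonal_def inner_commute)
    then have "orthogonal x x"
      using x(3) B(5)[of m] orthogonal_to_span by blast
    with \<open>x \<noteq> 0\<close> show False by (simp add: orthogonal_def)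
  qed
  then have "card C = CARD('n)"
    using dim_span_eq_card_independent[OF ind] by simp
  moreover have "card C = (\<Sum>\<mu>\<in>\<Lambda>. card (B \<mu>))"
    unfolding C_def
  proof (rule card_UN_disjoint[OF fin\<Lambda>])
    show "\<forall>\<mu>\<in>\<Lambda>. finite (B \<mu>)"
      using fin by (metis C_def UN_upper finite_subset)
    show "\<forall>i\<in>\<Lambda>. \<forall>j\<in>\<Lambda>. i \<noteq> j \<longrightarrow> B i \<inter> B j = {}"
      using disj by blast
  qed
  ultimately show "(\<Sum>\<mu>\<in>\<Lambda>. dim (eigenspace A \<mu>)) = CARD('n)"
    by (simp add: B(4))
qed

lemma mset_eigenvalue_list:
  fixes A :: "real^'n^'n"
  assumes "transpose A = A"
  shows "count (mset (eigenvalue_list A)) \<mu> = dim (eigenspace A \<mu>)"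
proof -
  have fin: "finite {\<mu>. eigenspace A \<mu> \<noteq> {0}}"
    by (rule spectral_dimension[OF assms])
  have "count (mset (eigenvalue_list A)) \<mu> =
      (\<Sum>\<nu>\<in>{\<mu>. eigenspace A \<mu> \<noteq> {0}}. if \<nu> = \<mu> then dim (eigenspace A \<mu>) else 0)"
    unfolding eigenvalue_list_def mset_sorted_list_of_multiset count_sum
    by (intro sum.cong) auto
  also have "\<dots> = dim (eigenspace A \<mu>)"
    using fin by (auto simp: sum.delta)
  finally show ?thesis .
qed

lemma length_eigenvalue_list:
  fixes A :: "real^'n^'n"
  assumes "transpose A = A"
  shows "length (eigenvalue_list A) = CARD('n)"
proof -
  have "length (eigenvalue_list A) = size (mset (eigenvalue_list A))" by simp
  also have "\<dots> = CARD('n)"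
    unfolding eigenvalue_list_def mset_sorted_list_of_multiset size_multiset_sum size_replicate_mset
    by (rule spectral_dimension[OF assms])
  finally show ?thesis .
qed

lemma sorted_eigenvalue_list: "sorted (eigenvalue_list A)"
  by (simp add: eigenvalue_list_def)

lemma set_eigenvalue_list:
  fixes A :: "real^'n^'n"
  assumes "transpose A = A"
  shows "\<mu> \<in> set (eigenvalue_list A) \<longleftrightarrow> (\<exists>x\<in>eigenspace A \<mu>. norm x = 1)"
proof -
  have "\<mu> \<in> set (eigenvalue_list A) \<longleftrightarrow> eigenspace A \<mu> \<noteq> {0}"
  proof -
    have "\<mu> \<in> set (eigenvalue_list A) \<longleftrightarrow> dim (eigenspace A \<mu>) \<noteq> 0"
      unfolding mset_eigenvalue_list[OF assms, symmetric] count_eq_zero_iff by simp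
    also have "\<dots> \<longleftrightarrow> eigenspace A \<mu> \<noteq> {0}"
      using subspace_0[OF subspace_eigenspace[of A \<mu>]] by (simp add: set_eq_subset)
    finally show ?thesis .
  qed
  also have "\<dots> \<longleftrightarrow> (\<exists>x\<in>eigenspace A \<mu>. norm x = 1)"
  proof
    assume "eigenspace A \<mu> \<noteq> {0}"
    then obtain x where "x \<in> eigenspace A \<mu>" "x \<noteq> 0"
      using subspace_0[OF subspace_eigenspace[of A \<mu>]] by blast
    then show "\<exists>x\<in>eigenspace A \<mu>. norm x = 1"
      by (rule subspace_has_unit_vector[OF subspace_eigenspace])
  next
    assume "\<exists>x\<in>eigenspace A \<mu>. norm x = 1"
    then show "eigenspace A \<mu> \<noteq> {0}"
      by (metis norm_zero singletonD zero_neq_one)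
  qed
  finally show ?thesis .
qed

lemma eigenvector_rayleigh:
  assumes "x \<in> eigenspace A \<mu>" "norm x = 1"
  shows "x \<bullet> (A *v x) = \<mu>"
  using assms by (simp add: eigenspace_def dot_square_norm)

text \<open>
  Minimizing the form of \<open>- A\<close> yields an eigenvector of \<open>A\<close> at which the form of \<open>A\<close> is largest, and the
  last entry of the sorted list is at least the corresponding eigenvalue.
\<close>

lemma largest_eigenvalue:
  fixes A :: "real^'n^'n"
  assumes sym: "transpose A = A"
  defines "M \<equiv> eigenvalue_list A ! (CARD('n) - 1)"
  shows "\<exists>x\<in>eigenspace A M. norm x = 1" "\<And>y. norm y = 1 \<Longrightarrow> y \<bullet> (A *v y) \<le> M"
proof -
  have len: "length (eigenvalue_list A) = CARD('n)"
    by (rule length_eigenvalue_list[OF sym])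
  have pos: "CARD('n) > 0" by simp
  have "M \<in> set (eigenvalue_list A)"
    unfolding M_def using len pos by (intro nth_mem) linarith
  then show "\<exists>x\<in>eigenspace A M. norm x = 1"
    by (simp add: set_eigenvalue_list[OF sym])
  have "transpose (- A) = - A"
    using sym by (simp add: transpose_minus)
  moreover have "(UNIV :: (real^'n) set) \<noteq> {0}"
    by (metis UNIV_I one_neq_zero singletonD)
  ultimately obtain x m where x: "norm x = 1" "x \<in> eigenspace (- A) m"
    and min: "\<And>y. norm y = 1 \<Longrightarrow> m \<le> y \<bullet> (- A *v y)"
    using exists_minimal_eigenvector[of "- A" UNIV] by auto
  have "x \<in> eigenspace A (- m)"
    using x(2) by (simp add: eigenspace_def minus_matrix_vector_mult minus_equation_iff eq_commute)
  with x(1) have "- m \<in> set (eigenvalue_list A)"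
    by (auto simp: set_eigenvalue_list[OF sym])
  then obtain i where "i < CARD('n)" "eigenvalue_list A ! i = - m"
    using len by (auto simp: in_set_conv_nth)
  then have "- m \<le> M"
    unfolding M_def using sorted_nth_mono[OF sorted_eigenvalue_list[of A], of i "CARD('n) - 1"] len
    by simp
  then show "y \<bullet> (A *v y) \<le> M" if "norm y = 1" for y
    using min[OF that] by (simp add: minus_matrix_vector_mult)
qed

text \<open>
  The smallest eigenvalue is 0, with eigenvector \<open>u\<close>, so the second entry of the sorted list is the
  least eigenvalue of \<open>A\<close> on the orthogonal complement of \<open>u\<close>. Counting multiplicities covers the case
  in which that eigenvalue is again 0.
\<close>

lemma second_eigenvalue:
  fixes A :: "real^'n^'n" and u :: "real^'n"
  assumes sym: "transpose A = A" and psd: "\<And>y. 0 \<le> y \<bullet> (A *v y)"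
    and u: "A *v u = 0" "u \<noteq> 0" and card: "CARD('n) \<ge> 2"
  defines "m \<equiv> eigenvalue_list A ! 1"
  shows "\<exists>x\<in>eigenspace A m. norm x = 1 \<and> u \<bullet> x = 0"
    "\<And>y. norm y = 1 \<Longrightarrow> u \<bullet> y = 0 \<Longrightarrow> m \<le> y \<bullet> (A *v y)"
proof -
  define xs where "xs = eigenvalue_list A"
  have len: "length xs = CARD('n)"
    unfolding xs_def by (rule length_eigenvalue_list[OF sym])
  have nonneg: "0 \<le> \<mu>" if "\<mu> \<in> set xs" for \<mu>
    using that psd unfolding xs_def set_eigenvalue_list[OF sym] by (metis eigenvector_rayleigh)
  have u0: "u \<in> eigenspace A 0"
    using u by (simp add: eigenspace_def)
  have "0 \<in> set xs"
    unfolding xs_def set_eigenvalue_list[OF sym]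
    by (rule subspace_has_unit_vector[OF subspace_eigenspace u0 u(2)])
  obtain h ys where xs: "xs = h # ys"
    using len by (cases xs) auto
  have srt: "sorted xs"
    unfolding xs_def by (rule sorted_eigenvalue_list)
  have h: "h = 0"
    using \<open>0 \<in> set xs\<close> srt nonneg[of h] by (auto simp: xs)
  obtain k zs where ys: "ys = k # zs"
    using len card by (cases ys) (auto simp: xs)
  have km: "k = m"
    by (simp add: m_def flip: xs_def) (simp add: xs ys)
  \<comment> \<open>Removing the copy of 0 that belongs to u leaves the spectrum of A on the complement of u.\<close>
  have mem: "\<mu> \<in> set ys \<longleftrightarrow> (\<exists>x\<in>eigenspace A \<mu>. norm x = 1 \<and> u \<bullet> x = 0)" for \<mu>
  proof (cases "\<mu> = 0")
    case False
    then show ?thesis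
      using set_eigenvalue_list[OF sym, of \<mu>] eigenspaces_orthogonal[OF sym u0, of _ \<mu>]
      by (auto simp: xs h simp flip: xs_def)
  next
    case True
    have "count (mset xs) 0 = Suc (count (mset ys) 0)"
      by (simp add: xs h)
    then have "0 \<in> set ys \<longleftrightarrow> dim (eigenspace A 0) \<ge> 2"
      using mset_eigenvalue_list[OF sym, of 0] count_greater_zero_iff[of "mset ys" 0]
      unfolding set_mset_mset xs_def[symmetric] by linarith
    also have "\<dots> \<longleftrightarrow> (\<exists>x\<in>eigenspace A 0. norm x = 1 \<and> u \<bullet> x = 0)"
    proof
      assume "dim (eigenspace A 0) \<ge> 2"
      have span_ker: "span (eigenspace A 0) = eigenspace A 0"
        using subspace_eigenspace unfolding span_eq_iff .
      have "dim (span {u}) \<le> 1"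
        using dim_le_card'[of "{u}"] by simp
      with \<open>dim (eigenspace A 0) \<ge> 2\<close> have "span {u} \<noteq> eigenspace A 0"
        by (metis One_nat_def Suc_1 not_less_eq_eq)
      moreover have "span {u} \<subseteq> eigenspace A 0"
        using u0 by (intro span_minimal subspace_eigenspace) auto
      ultimately have "span {u} \<subset> span (eigenspace A 0)"
        unfolding span_ker by blast
      then obtain x where x: "x \<noteq> 0" "x \<in> span (eigenspace A 0)" "\<And>y. y \<in> span {u} \<Longrightarrow> orthogonal x y"
        using orthogonal_to_subspace_exists_gen by metis
      have "x \<in> eigenspace A 0"
        using x(2) unfolding span_ker .
      moreover have "u \<bullet> x = 0"
        using x(3)[of u] by (simp add: orthogonal_def inner_commute span_base)
      ultimately show "\<exists>x\<in>eigenspace A 0. norm x = 1 \<and> u \<bullet> x = 0"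
        using x(1) subspace_has_unit_vector[of "eigenspace A 0 \<inter> {x. u \<bullet> x = 0}" x]
          subspace_inter[OF subspace_eigenspace subspace_hyperplane, of A 0 u] by auto
    next
      assume "\<exists>x\<in>eigenspace A 0. norm x = 1 \<and> u \<bullet> x = 0"
      then obtain x where x: "x \<in> eigenspace A 0" "norm x = 1" "u \<bullet> x = 0" by blast
      have "x \<noteq> u" using x u(2) by auto
      have "independent {u, x}"
        using x u(2) by (intro pairwise_orthogonal_independent)
          (auto simp: pairwise_def orthogonal_def inner_commute)
      then have "card {u, x} \<le> dim (eigenspace A 0)"
        using u0 x(1) by (intro independent_card_le_dim) auto
      with \<open>x \<noteq> u\<close> show "dim (eigenspace A 0) \<ge> 2" by simp
    qed
    finally show ?thesis using True by simp
  qed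
  have "m \<in> set ys" by (simp add: ys km)
  with mem show ex: "\<exists>x\<in>eigenspace A m. norm x = 1 \<and> u \<bullet> x = 0" by blast
  define U where "U = {y. u \<bullet> y = 0}"
  have U: "subspace U" unfolding U_def by (rule subspace_hyperplane)
  obtain x\<^sub>0 where "u \<bullet> x\<^sub>0 = 0" "norm x\<^sub>0 = 1" using ex by blast
  then have "x\<^sub>0 \<in> U" "x\<^sub>0 \<noteq> 0" by (auto simp: U_def)
  then have "U \<noteq> {0}" by blast
  moreover have "A *v y \<in> U" for y
    using symmetric_matrix_inner[OF sym, of u y] u(1) by (simp add: U_def)
  ultimately obtain x \<mu> where x: "x \<in> U" "norm x = 1" "x \<in> eigenspace A \<mu>"
    and min: "\<And>y. y \<in> U \<Longrightarrow> norm y = 1 \<Longrightarrow> \<mu> \<le> y \<bullet> (A *v y)"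
    using exists_minimal_eigenvector[OF sym U] by blast
  have "\<mu> \<in> set ys" using x by (auto simp: mem U_def)
  then have "m \<le> \<mu>" using srt by (auto simp: xs ys km)
  then show "m \<le> y \<bullet> (A *v y)" if "norm y = 1" "u \<bullet> y = 0" for y
    using min[of y] that by (simp add: U_def)
qed

section \<open>The Dirichlet form and the extremal Laplacian eigenvalues\<close>

definition dirichlet_form :: "'v set set \<Rightarrow> ('v set \<Rightarrow> real) \<Rightarrow> real^'v \<Rightarrow> real" where
  "dirichlet_form E w \<phi> = (\<Sum>e\<in>E. w e * edge_energy \<phi> e)"

lemma simple_graph_edge:
  assumes "simple_graph E" "e \<in> E"
  obtains u v where "e = {u, v}"
  using assms by (auto simp: simple_graph_def card_2_iff)

lemma edge_energy_nonneg:
  assumes "simple_graph E" "e \<in> E"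
  shows "0 \<le> edge_energy \<phi> e"
  by (rule simple_graph_edge[OF assms]) simp

lemma dirichlet_form_nonneg:
  assumes "simple_graph E" "\<forall>e\<in>E. 0 \<le> w e"
  shows "0 \<le> dirichlet_form E w \<phi>"
  using assms by (auto simp: dirichlet_form_def intro!: sum_nonneg mult_nonneg_nonneg edge_energy_nonneg)

lemma continuous_edge_energy:
  fixes E :: "'v::finite set set"
  assumes "simple_graph E" "e \<in> E"
  shows "continuous_on A (\<lambda>\<phi>. edge_energy \<phi> e)"
  by (rule simple_graph_edge[OF assms]) (simp add: continuous_intros)

lemma continuous_dirichlet_form:
  fixes E :: "'v::finite set set"
  assumes "simple_graph E"
  shows "continuous_on A (dirichlet_form E w)"
  unfolding dirichlet_form_def
  by (intro continuous_on_sum continuous_on_mult continuous_on_const continuous_edge_energy[OF assms])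

text \<open>
  The constant vector has zero energy and thus minimizes the nonnegative Dirichlet form.
\<close>

lemma laplacian_ones:
  fixes E :: "'v::finite set set"
  assumes simple: "simple_graph E" and w: "\<forall>e\<in>E. 0 \<le> w e"
  shows "laplacian E w *v 1 = 0"
proof -
  have "edge_energy 1 e = 0" if "e \<in> E" for e
    by (rule simple_graph_edge[OF simple that]) simp
  then have "dirichlet_form E w 1 = 0"
    by (simp add: dirichlet_form_def)
  then have "1 \<in> eigenspace (laplacian E w) 0"
    using dirichlet_form_nonneg[OF simple w]
    by (intro rayleigh_minimizer_in_eigenspace[where U = UNIV])
      (auto simp: transpose_laplacian laplacian_quadratic_form[OF simple] simp flip: dirichlet_form_def)
  then show ?thesis by (simp add: eigenspace_def)
qed

lemma second_laplacian_eigenvalue: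
  fixes E :: "'v::finite set set"
  assumes simple: "simple_graph E" and w: "\<forall>e\<in>E. 0 \<le> w e" and card: "CARD('v) \<ge> 2"
  shows "\<exists>\<phi>. norm \<phi> = 1 \<and> 1 \<bullet> \<phi> = 0 \<and> dirichlet_form E w \<phi> = lap_eigenvalue E w 2"
    and "\<And>\<phi>. norm \<phi> = 1 \<Longrightarrow> 1 \<bullet> \<phi> = 0 \<Longrightarrow> lap_eigenvalue E w 2 \<le> dirichlet_form E w \<phi>"
proof -
  have q: "\<phi> \<bullet> (laplacian E w *v \<phi>) = dirichlet_form E w \<phi>" for \<phi>
    by (simp add: laplacian_quadratic_form[OF simple] dirichlet_form_def)
  have psd: "0 \<le> \<phi> \<bullet> (laplacian E w *v \<phi>)" for \<phi>
    unfolding q by (rule dirichlet_form_nonneg[OF simple w])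
  have l: "lap_eigenvalue E w 2 = eigenvalue_list (laplacian E w) ! 1"
    by (simp add: lap_eigenvalue_def)
  have one: "(1 :: real^'v) \<noteq> 0" by simp
  note second = second_eigenvalue[OF transpose_laplacian psd laplacian_ones[OF simple w] one card,
      folded l, unfolded q]
  show "\<exists>\<phi>. norm \<phi> = 1 \<and> 1 \<bullet> \<phi> = 0 \<and> dirichlet_form E w \<phi> = lap_eigenvalue E w 2"
    using second(1) eigenvector_rayleigh[of _ "laplacian E w"] unfolding q by blast
  show "\<And>\<phi>. norm \<phi> = 1 \<Longrightarrow> 1 \<bullet> \<phi> = 0 \<Longrightarrow> lap_eigenvalue E w 2 \<le> dirichlet_form E w \<phi>"
    by (rule second(2))
qed

lemma last_laplacian_eigenvalue:
  fixes E :: "'v::finite set set"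
  assumes simple: "simple_graph E"
  shows "\<exists>\<phi>. norm \<phi> = 1 \<and> dirichlet_form E w \<phi> = lap_eigenvalue E w CARD('v)"
    and "\<And>\<phi>. norm \<phi> = 1 \<Longrightarrow> dirichlet_form E w \<phi> \<le> lap_eigenvalue E w CARD('v)"
proof -
  have q: "\<phi> \<bullet> (laplacian E w *v \<phi>) = dirichlet_form E w \<phi>" for \<phi>
    by (simp add: laplacian_quadratic_form[OF simple] dirichlet_form_def)
  note last = largest_eigenvalue[OF transpose_laplacian[of E w], folded lap_eigenvalue_def, unfolded q]
  show "\<exists>\<phi>. norm \<phi> = 1 \<and> dirichlet_form E w \<phi> = lap_eigenvalue E w CARD('v)"
    using last(1) eigenvector_rayleigh[of _ "laplacian E w"] unfolding q by blast
  show "\<And>\<phi>. norm \<phi> = 1 \<Longrightarrow> dirichlet_form E w \<phi> \<le> lap_eigenvalue E w CARD('v)"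
    by (rule last(2))
qed

lemma connected_zero_energy_constant:
  fixes E :: "'v::finite set set"
  assumes "connected_graph E" and zero: "\<And>e. e \<in> E \<Longrightarrow> edge_energy \<phi> e = 0"
  shows "\<phi> $ u = \<phi> $ v"
proof -
  have "(u, v) \<in> {(x, y). {x, y} \<in> E}\<^sup>*"
    using assms(1) by (auto simp: connected_graph_def)
  then show ?thesis
  proof (induction rule: rtrancl_induct)
    case (step y z)
    then show ?case using zero[of "{y, z}"] by auto
  qed simp
qed

text \<open>
  A vector of zero energy is constant on a connected graph, so it is zero if it is also orthogonal to
  the constants.
\<close>

lemma second_laplacian_eigenvalue_pos:
  fixes E :: "'v::finite set set"
  assumes simple: "simple_graph E" and conn: "connected_graph E" and card: "CARD('v) \<ge> 2"
  shows "lap_eigenvalue E (\<lambda>_. 1) 2 > 0"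
proof (rule ccontr)
  assume neg: "\<not> ?thesis"
  have nonneg: "\<forall>e\<in>E. (0::real) \<le> 1" by simp
  obtain \<phi> :: "real^'v" where \<phi>: "norm \<phi> = 1" "1 \<bullet> \<phi> = 0"
    "dirichlet_form E (\<lambda>_. 1) \<phi> = lap_eigenvalue E (\<lambda>_. 1) 2"
    using second_laplacian_eigenvalue(1)[OF simple nonneg card] by blast
  have "(\<Sum>e\<in>E. edge_energy \<phi> e) = 0"
    using neg \<phi>(3) edge_energy_nonneg[OF simple] sum_nonneg[of E "edge_energy \<phi>"]
    by (simp add: dirichlet_form_def)
  then have zero: "edge_energy \<phi> e = 0" if "e \<in> E" for e
    using that edge_energy_nonneg[OF simple] by (simp add: sum_nonneg_eq_0_iff)
  obtain u :: 'v where True by simp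
  have const: "\<phi> = (\<phi> $ u) *\<^sub>R 1"
    using connected_zero_energy_constant[OF conn zero, of _ u] by (simp add: vec_eq_iff)
  have "\<phi> \<bullet> \<phi> = (\<phi> $ u) * (1 \<bullet> \<phi>)"
    by (subst const) simp
  with \<phi>(1,2) show False by (simp add: dot_square_norm)
qed

section \<open>Edge-wise balance from rigidity\<close>

text \<open>
  A pointwise first-order increase at the minimizers suffices, by compactness: where \<open>g > 0\<close>, every
  step helps, and on the compact rest \<open>f\<close> exceeds \<open>m\<close> by a uniform gap while \<open>g\<close> is bounded below.
\<close>

lemma strict_minimum_perturbation:
  fixes f g :: "'a::t2_space \<Rightarrow> real"
  assumes S: "compact S" and f: "continuous_on S f" and g: "continuous_on S g"
    and min: "\<And>x. x \<in> S \<Longrightarrow> m \<le> f x" and pos: "\<And>x. x \<in> S \<Longrightarrow> f x = m \<Longrightarrow> 0 < g x"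
  shows "\<exists>t\<^sub>0>0. \<forall>t x. 0 < t \<and> t \<le> t\<^sub>0 \<and> x \<in> S \<longrightarrow> m < f x + t * g x"
proof -
  define N where "N = S \<inter> g -` {..0}"
  have "closed N"
    unfolding N_def by (intro continuous_closed_preimage g compact_imp_closed S closed_atMost)
  then have N: "compact N"
    using compact_Int_closed[OF S, of N] by (simp add: N_def Int_absorb1 flip: Int_assoc)
  have NS: "N \<subseteq> S" by (auto simp: N_def)
  have large: "m < f x + t * g x" if "0 < t" "x \<in> S" "x \<notin> N" for t x
    using that add_le_less_mono[OF min[of x], of 0 "t * g x"] by (auto simp: N_def not_le)
  show ?thesis
  proof (cases "N = {}")
    case True
    with large show ?thesis by (intro exI[of _ 1]) auto
  next
    case False
    obtain x0 where x0: "x0 \<in> N" "\<And>x. x \<in> N \<Longrightarrow> f x0 \<le> f x"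
      using continuous_attains_inf[OF N False continuous_on_subset[OF f NS]] by blast
    obtain y0 where y0: "y0 \<in> N" "\<And>x. x \<in> N \<Longrightarrow> g y0 \<le> g x"
      using continuous_attains_inf[OF N False continuous_on_subset[OF g NS]] by blast
    have gap: "0 < f x0 - m"
      using min[of x0] pos[of x0] x0(1) by (fastforce simp: N_def)
    define b where "b = \<bar>g y0\<bar>"
    have b: "b \<ge> 0" by (simp add: b_def)
    show ?thesis
      (* a step t of at most this size costs at most t * b, which is less than the gap f x0 - m *)
    proof (intro exI[of _ "(f x0 - m) / (b + 1)"] conjI allI impI)
      show "(f x0 - m) / (b + 1) > 0" using gap b by simp
      fix t x assume "0 < t \<and> t \<le> (f x0 - m) / (b + 1) \<and> x \<in> S"
      then have t: "0 < t" "t \<le> (f x0 - m) / (b + 1)" and x: "x \<in> S" by auto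
      show "m < f x + t * g x"
      proof (cases "x \<in> N")
        case True
        have "t * (b + 1) \<le> f x0 - m"
          using t(2) b by (simp add: field_simps)
        then have "t * b < f x0 - m"
          using t(1) by (simp add: algebra_simps)
        moreover have "t * (- b) \<le> t * g x"
          using t(1) y0(2)[OF True] by (intro mult_left_mono) (auto simp: b_def)
        ultimately show ?thesis using x0(2)[OF True] by simp
      qed (use large t x in auto)
    qed
  qed
qed

text \<open>
  The convex duality step: were the constant vector outside the convex hull of the edge energy vectors
  of the minimizers, a separating direction would give a normalized weight with a larger minimum. The
  sign \<open>\<sigma>\<close> lets the same argument serve both ends of the spectrum.
\<close>

lemma extremal_rigidity_imp_edge_balance:
  fixes E :: "'v::finite set set" and S :: "(real^'v) set" and \<sigma> m :: real
  assumes simple: "simple_graph E" and E: "E \<noteq> {}" and S: "compact S"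
    and min: "\<And>\<phi>. \<phi> \<in> S \<Longrightarrow> m \<le> \<sigma> * dirichlet_form E (\<lambda>_. 1) \<phi>"
    and rigid: "\<And>w. normalized_weight E w \<Longrightarrow> \<exists>\<phi>\<in>S. \<sigma> * dirichlet_form E w \<phi> \<le> m"
  shows "\<exists>(r::nat) \<phi> a. (\<forall>i\<in>{1..r}. \<phi> i \<in> S \<and> \<sigma> * dirichlet_form E (\<lambda>_. 1) (\<phi> i) = m \<and> a i \<ge> 0)
           \<and> (\<Sum>i=1..r. a i) = 1
           \<and> (\<forall>e\<in>E. m / card E = (\<Sum>i=1..r. a i * (\<sigma> * edge_energy (\<phi> i) e)))"
proof -
  define M where "M = {\<phi>\<in>S. \<sigma> * dirichlet_form E (\<lambda>_. 1) \<phi> = m}"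
  define F :: "real^'v \<Rightarrow> real^('v set)" where
    "F \<phi> = (\<chi> e. if e \<in> E then \<sigma> * edge_energy \<phi> e else 0)" for \<phi>
  define p :: "real^('v set)" where "p = (\<chi> e. if e \<in> E then m / card E else 0)"
  have cardE: "card E > 0" using E by (simp add: card_gt_0_iff)
  have cont: "continuous_on A (\<lambda>\<phi>. \<sigma> * dirichlet_form E w \<phi>)" for A w
    by (intro continuous_intros continuous_dirichlet_form[OF simple])
  have inner: "b \<bullet> F \<phi> = \<sigma> * dirichlet_form E (($) b) \<phi>" for b \<phi>
    by (simp add: F_def inner_vec_def dirichlet_form_def sum_distrib_left if_distrib
        sum.If_cases mult_ac cong: if_cong)
  have "p \<in> convex hull (F ` M)"
  proof (rule ccontr)
    assume p: "p \<notin> convex hull (F ` M)"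
    have "M = S \<inter> (\<lambda>\<phi>. \<sigma> * dirichlet_form E (\<lambda>_. 1) \<phi>) -` {m}"
      by (auto simp: M_def)
    then have "closed M"
      using continuous_closed_preimage[OF cont compact_imp_closed[OF S] closed_singleton] by simp
    then have "compact M"
      using compact_Int_closed[OF S, of M] by (simp add: M_def Int_absorb1 subset_iff)
    moreover have "continuous_on M F"
      unfolding F_def
    proof (rule continuous_on_vec_lambda)
      show "continuous_on M (\<lambda>\<phi>. if e \<in> E then \<sigma> * edge_energy \<phi> e else 0)" for e
        by (cases "e \<in> E") (auto intro!: continuous_on_mult continuous_on_const continuous_edge_energy[OF simple])
    qed
    ultimately have "closed (convex hull (F ` M))"
      by (intro compact_imp_closed compact_convex_hull compact_continuous_image)
    then obtain b \<beta> where b: "b \<bullet> p < \<beta>" "\<And>x. x \<in> convex hull (F ` M) \<Longrightarrow> \<beta> < b \<bullet> x"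
      using separating_hyperplane_closed_point[OF convex_convex_hull _ p] by blast
    (* subtracting the mean d makes v an admissible direction: 1 + t * v keeps the total weight *)
    define d where "d = (\<Sum>e\<in>E. b $ e) / card E"
    define v where "v e = b $ e - d" for e
    have sum_v: "(\<Sum>e\<in>E. v e) = 0"
      using cardE by (simp add: v_def sum_subtractf d_def)
    have bp: "b \<bullet> p = d * m"
      by (simp add: p_def inner_vec_def d_def if_distrib sum.If_cases sum_divide_distrib
          sum_distrib_right cong: if_cong)
    have split: "dirichlet_form E (\<lambda>e. x + t * y e) \<phi> =
        x * dirichlet_form E (\<lambda>_. 1) \<phi> + t * dirichlet_form E y \<phi>" for x t y \<phi>
      by (simp add: dirichlet_form_def sum.distrib sum_distrib_left algebra_simps)
    have v_pos: "0 < \<sigma> * dirichlet_form E v \<phi>" if "\<phi> \<in> S" "\<sigma> * dirichlet_form E (\<lambda>_. 1) \<phi> = m" for \<phi>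
    proof -
      have "b \<bullet> p < b \<bullet> F \<phi>"
        using b that by (auto simp: M_def intro!: less_trans[OF b(1)] b(2) hull_inc)
      moreover have Dv: "dirichlet_form E v \<phi> = dirichlet_form E (($) b) \<phi> - d * dirichlet_form E (\<lambda>_. 1) \<phi>"
        using split[of "- d" 1 "($) b" \<phi>] by (simp add: v_def[abs_def])
      then have "\<sigma> * dirichlet_form E v \<phi> = b \<bullet> F \<phi> - d * (\<sigma> * dirichlet_form E (\<lambda>_. 1) \<phi>)"
        by (simp add: inner Dv algebra_simps)
      ultimately show ?thesis using bp that(2) by simp
    qed
    have "\<exists>t\<^sub>0>0. \<forall>t \<phi>. 0 < t \<and> t \<le> t\<^sub>0 \<and> \<phi> \<in> S \<longrightarrow>
        m < \<sigma> * dirichlet_form E (\<lambda>_. 1) \<phi> + t * (\<sigma> * dirichlet_form E v \<phi>)"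
      by (rule strict_minimum_perturbation[OF S cont cont min v_pos])
    then obtain t\<^sub>0 where t0: "t\<^sub>0 > 0" "\<forall>t \<phi>. 0 < t \<and> t \<le> t\<^sub>0 \<and> \<phi> \<in> S \<longrightarrow>
        m < \<sigma> * dirichlet_form E (\<lambda>_. 1) \<phi> + t * (\<sigma> * dirichlet_form E v \<phi>)"
      by blast
    (* B bounds v on the edges, and t * (B + 1) <= 1 keeps the weights nonnegative *)
    define B where "B = (\<Sum>e\<in>E. \<bar>v e\<bar>)"
    have B: "\<bar>v e\<bar> \<le> B" if "e \<in> E" for e
      unfolding B_def using that by (intro member_le_sum) auto
    have B0: "B \<ge> 0" by (simp add: B_def sum_nonneg)
    define t where "t = min t\<^sub>0 (1 / (B + 1))"
    have t: "0 < t" "t \<le> t\<^sub>0" "t * (B + 1) \<le> 1"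
      using t0(1) B0 by (auto simp: t_def min_def field_simps)
    have "normalized_weight E (\<lambda>e. 1 + t * v e)"
      unfolding normalized_weight_def
    proof (intro conjI ballI)
      fix e assume "e \<in> E"
      have "t * (- (B + 1)) \<le> t * v e"
        using t(1) B[OF \<open>e \<in> E\<close>] by (intro mult_left_mono) auto
      then have "- (t * (B + 1)) \<le> t * v e"
        by (simp only: mult_minus_right)
      then show "0 \<le> 1 + t * v e" using t(3) by linarith
    next
      show "(\<Sum>e\<in>E. 1 + t * v e) = real (card E)"
        by (simp add: sum.distrib sum_v flip: sum_distrib_left)
    qed
    from rigid[OF this] obtain \<phi> where "\<phi> \<in> S" "\<sigma> * dirichlet_form E (\<lambda>e. 1 + t * v e) \<phi> \<le> m"
      by blast
    moreover from this t t0(2) have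
      "m < \<sigma> * dirichlet_form E (\<lambda>_. 1) \<phi> + t * (\<sigma> * dirichlet_form E v \<phi>)"
      by blast
    ultimately show False
      unfolding split by (simp add: algebra_simps)
  qed
  then obtain k a x where ax: "\<forall>i\<in>{1..k::nat}. 0 \<le> a i \<and> x i \<in> F ` M" "sum a {1..k} = 1"
    "(\<Sum>i=1..k. a i *\<^sub>R x i) = p"
    unfolding convex_hull_indexed mem_Collect_eq by (elim exE conjE) (rule that)
  obtain \<phi> where \<phi>: "\<And>i. i \<in> {1..k} \<Longrightarrow> \<phi> i \<in> M \<and> x i = F (\<phi> i)"
    using ax(1) unfolding image_iff by metis
  have "m / card E = (\<Sum>i=1..k. a i * (\<sigma> * edge_energy (\<phi> i) e))" if "e \<in> E" for e
  proof -
    have "m / card E = p $ e" using that by (simp add: p_def)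
    also have "\<dots> = (\<Sum>i=1..k. a i * x i $ e)" by (simp flip: ax(3))
    also have "\<dots> = (\<Sum>i=1..k. a i * (\<sigma> * edge_energy (\<phi> i) e))"
      using that \<phi> by (intro sum.cong) (auto simp: F_def)
    finally show ?thesis .
  qed
  then show ?thesis
    using ax \<phi> by (intro exI[of _ k] exI[of _ \<phi>] exI[of _ a]) (auto simp: M_def)
qed

section \<open>Averaging over a group of automorphisms\<close>

definition permute_vec :: "('v \<Rightarrow> 'v) \<Rightarrow> real^'v \<Rightarrow> real^'v" where
  "permute_vec g \<phi> = (\<chi> v. \<phi> $ g v)"

lemma norm_permute_vec:
  fixes \<phi> :: "real^'v::finite"
  assumes "bij g"
  shows "norm (permute_vec g \<phi>) = norm \<phi>"
  using sum.reindex_bij_betw[OF assms, of "\<lambda>v. (\<phi> $ v)\<^sup>2"]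
  by (simp add: permute_vec_def norm_vec_def L2_set_def)

lemma inner_ones_permute_vec:
  fixes \<phi> :: "real^'v::finite"
  assumes "bij g"
  shows "1 \<bullet> permute_vec g \<phi> = 1 \<bullet> \<phi>"
  using sum.reindex_bij_betw[OF assms, of "\<lambda>v. \<phi> $ v"]
  by (simp add: permute_vec_def inner_vec_def)

lemma edge_energy_permute_vec:
  assumes "simple_graph E" "e \<in> E"
  shows "edge_energy (permute_vec g \<phi>) e = edge_energy \<phi> (g ` e)"
  by (rule simple_graph_edge[OF assms]) (simp add: permute_vec_def)

lemma Aut_subgroup:
  assumes "subgroup \<Psi> (Aut_group E)"
  shows "g \<in> \<Psi> \<Longrightarrow> bij g" "g \<in> \<Psi> \<Longrightarrow> {u, v} \<in> E \<Longrightarrow> {g u, g v} \<in> E"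
    "g \<in> \<Psi> \<Longrightarrow> h \<in> \<Psi> \<Longrightarrow> g \<circ> h \<in> \<Psi>" "id \<in> \<Psi>"
proof -
  have carrier: "carrier (Aut_group E) = {g. bij g \<and> (\<forall>u v. {u, v} \<in> E \<longleftrightarrow> {g u, g v} \<in> E)}"
    by (simp add: Aut_group_def)
  show *: "bij g" if "g \<in> \<Psi>" for g
    using subgroup.mem_carrier[OF assms that] unfolding carrier by blast
  show "g \<in> \<Psi> \<Longrightarrow> {u, v} \<in> E \<Longrightarrow> {g u, g v} \<in> E"
    using subgroup.mem_carrier[OF assms, of g] unfolding carrier by blast
  show "g \<in> \<Psi> \<Longrightarrow> h \<in> \<Psi> \<Longrightarrow> g \<circ> h \<in> \<Psi>"
    using subgroup.m_closed[OF assms, of g h] *[of g] *[of h]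
    by (simp add: Aut_group_def BijGroup_def Bij_def extensional_def compose_def comp_def restrict_def)
  show "id \<in> \<Psi>"
    using subgroup.one_closed[OF assms] by (simp add: Aut_group_def BijGroup_def id_def restrict_def)
qed

lemma Aut_subgroup_edge:
  assumes "simple_graph E" "subgroup \<Psi> (Aut_group E)" "g \<in> \<Psi>" "e \<in> E"
  shows "g ` e \<in> E"
  by (rule simple_graph_edge[OF assms(1,4)]) (use assms Aut_subgroup(2)[OF assms(2,3)] in auto)

lemma edge_orbits_eq:
  "edge_orbits E \<Psi> = (\<lambda>e. (\<lambda>g. g ` e) ` \<Psi>) ` E"
  by (auto simp: edge_orbits_def orbits_def orbit_def image_def)

text \<open>
  Used both for the whole edge set and for a single orbit; finiteness upgrades injective to bijective.
\<close>

lemma bij_betw_image_closed: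
  fixes g :: "'v::finite \<Rightarrow> 'v"
  assumes "bij g" "\<And>e. e \<in> X \<Longrightarrow> g ` e \<in> X"
  shows "bij_betw ((`) g) X X"
proof -
  have "inj_on ((`) g) X"
    using bij_is_inj[OF assms(1)] by (auto simp: inj_on_def inj_image_eq_iff)
  with assms(2) show ?thesis
    unfolding bij_betw_def by (intro conjI endo_inj_surj) auto
qed

lemma dirichlet_form_permute_vec:
  fixes E :: "'v::finite set set"
  assumes simple: "simple_graph E" and \<Psi>: "subgroup \<Psi> (Aut_group E)" and g: "g \<in> \<Psi>"
  shows "dirichlet_form E (\<lambda>_. 1) (permute_vec g \<phi>) = dirichlet_form E (\<lambda>_. 1) \<phi>"
  using sum.reindex_bij_betw[OF bij_betw_image_closed[OF Aut_subgroup(1)[OF \<Psi> g]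
      Aut_subgroup_edge[OF simple \<Psi> g]], of "edge_energy \<phi>"]
  by (simp add: dirichlet_form_def edge_energy_permute_vec[OF simple])

text \<open>
  The sum over \<open>\<Psi>\<close> takes the same value at all edges of an orbit, because right translation permutes
  \<open>\<Psi>\<close>. Its total over an orbit is \<open>card \<Psi>\<close> times the orbit energy, because every group element permutes
  the orbit. This double count replaces the orbit-stabilizer theorem.
\<close>

lemma orbit_balance_imp_edge_balance:
  fixes E :: "'v::finite set set" and \<phi> :: "nat \<Rightarrow> real^'v" and c :: real
  assumes simple: "simple_graph E" and \<Psi>: "subgroup \<Psi> (Aut_group E)"
    and Os: "bij_betw Os {1..s} (edge_orbits E \<Psi>)"
    and balance: "\<And>j. j \<in> {1..s} \<Longrightarrow>
      c * real (card (Os j)) = (\<Sum>i=1..r. a i * orbit_energy Os (\<phi> i) j)"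
    and e: "e \<in> E"
  shows "(\<Sum>i=1..r. a i * (\<Sum>g\<in>\<Psi>. edge_energy (\<phi> i) (g ` e))) = card \<Psi> * c"
proof -
  define F where "F e = (\<Sum>i=1..r. a i * (\<Sum>g\<in>\<Psi>. edge_energy (\<phi> i) (g ` e)))" for e
  define O' where "O' = (\<lambda>g. g ` e) ` \<Psi>"
  have "O' \<in> edge_orbits E \<Psi>"
    using e by (auto simp: edge_orbits_eq O'_def)
  with Os have "O' \<in> Os ` {1..s}"
    by (simp add: bij_betw_def)
  then obtain j where j: "j \<in> {1..s}" "Os j = O'"
    by blast
  have "O' \<noteq> {}" using Aut_subgroup(4)[OF \<Psi>] by (auto simp: O'_def)
  have orbit_closed: "g ` x \<in> O'" if "g \<in> \<Psi>" "x \<in> O'" for g x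
  proof -
    obtain h where h: "h \<in> \<Psi>" "x = h ` e" using \<open>x \<in> O'\<close> by (auto simp: O'_def)
    have "g ` x = (g \<circ> h) ` e" by (simp add: h(2) image_comp)
    then show ?thesis
      using Aut_subgroup(3)[OF \<Psi> \<open>g \<in> \<Psi>\<close> h(1)] unfolding O'_def by blast
  qed
  have invariant: "F x = F e" if "x \<in> O'" for x
  proof -
    obtain h where h: "h \<in> \<Psi>" "x = h ` e" using \<open>x \<in> O'\<close> by (auto simp: O'_def)
    have "inj_on (\<lambda>g. g \<circ> h) \<Psi>"
      using bij_is_surj[OF Aut_subgroup(1)[OF \<Psi> h(1)]] by (auto simp: inj_on_def fun_eq_iff) (metis surjD)
    then have "bij_betw (\<lambda>g. g \<circ> h) \<Psi> \<Psi>"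
      unfolding bij_betw_def using Aut_subgroup(3)[OF \<Psi> _ h(1)] by (intro conjI endo_inj_surj) auto
    from sum.reindex_bij_betw[OF this, of "\<lambda>g. edge_energy _ (g ` e)"]
    show ?thesis by (simp add: F_def h(2) image_comp)
  qed
  have "card O' * F e = (\<Sum>x\<in>O'. F x)"
    using invariant by simp
  also have "\<dots> = (\<Sum>i=1..r. a i * (\<Sum>g\<in>\<Psi>. \<Sum>x\<in>O'. edge_energy (\<phi> i) (g ` x)))"
    unfolding F_def
    by (subst sum.swap) (simp add: sum_distrib_left sum.swap[of _ \<Psi> O'])
  also have "\<dots> = (\<Sum>i=1..r. a i * (\<Sum>g\<in>\<Psi>. orbit_energy Os (\<phi> i) j))"
  proof (intro sum.cong refl arg_cong2[of _ _ _ _ "(*)"])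
    fix i g assume g: "g \<in> \<Psi>"
    show "(\<Sum>x\<in>O'. edge_energy (\<phi> i) (g ` x)) = orbit_energy Os (\<phi> i) j"
      using sum.reindex_bij_betw[OF bij_betw_image_closed[OF Aut_subgroup(1)[OF \<Psi> g] orbit_closed[OF g]]]
      by (simp add: orbit_energy_def j(2))
  qed
  also have "\<dots> = card \<Psi> * (c * card O')"
    using balance[OF j(1)] by (simp add: j(2) sum_distrib_left mult_ac)
  finally show ?thesis using \<open>O' \<noteq> {}\<close> by (simp add: F_def)
qed

text \<open>
  The values of \<open>\<sigma> * D w\<close> at the translates of the \<open>\<phi> i\<close>, averaged over \<open>\<Psi>\<close> and weighted by \<open>a\<close>, depend on
  \<open>w\<close> only through its total weight, because the averaged energy is the same on all edges. So
  their mean is what it is for the weight 1, namely \<open>m\<close>, and they cannot all exceed \<open>m\<close>.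
\<close>

lemma orbit_balance_imp_extremal_rigidity:
  fixes E :: "'v::finite set set" and \<phi> :: "nat \<Rightarrow> real^'v" and c :: real
  assumes simple: "simple_graph E" and \<Psi>: "subgroup \<Psi> (Aut_group E)"
    and Os: "bij_betw Os {1..s} (edge_orbits E \<Psi>)"
    and S: "\<And>g \<phi>. bij g \<Longrightarrow> \<phi> \<in> S \<Longrightarrow> permute_vec g \<phi> \<in> S"
    and \<phi>: "\<And>i. i \<in> {1..r} \<Longrightarrow> \<phi> i \<in> S \<and> \<sigma> * dirichlet_form E (\<lambda>_. 1) (\<phi> i) = m \<and> a i \<ge> 0"
    and a: "(\<Sum>i=1..r. a i) = 1"
    and balance: "\<And>j. j \<in> {1..s} \<Longrightarrow>
      c * real (card (Os j)) = (\<Sum>i=1..r. a i * orbit_energy Os (\<phi> i) j)"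
    and w: "normalized_weight E w"
  shows "\<exists>\<phi>\<in>S. \<sigma> * dirichlet_form E w \<phi> \<le> m"
proof (rule ccontr)
  assume contra: "\<not> ?thesis"
  define X where "X w i = (\<Sum>g\<in>\<Psi>. \<sigma> * dirichlet_form E w (permute_vec g (\<phi> i)))" for w i
  have card: "card \<Psi> > 0"
    using Aut_subgroup(4)[OF \<Psi>] by (auto simp: card_gt_0_iff)
  have total: "(\<Sum>i=1..r. a i * X w i) = \<sigma> * card \<Psi> * c * card E" if "normalized_weight E w" for w
  proof -
    have "(\<Sum>i=1..r. a i * X w i) =
        (\<Sum>i=1..r. \<Sum>g\<in>\<Psi>. \<Sum>e\<in>E. \<sigma> * (w e * (a i * edge_energy (\<phi> i) (g ` e))))"
      by (simp add: X_def dirichlet_form_def edge_energy_permute_vec[OF simple] sum_distrib_left mult_ac)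
    also have "\<dots> = (\<Sum>i=1..r. \<Sum>e\<in>E. \<Sum>g\<in>\<Psi>. \<sigma> * (w e * (a i * edge_energy (\<phi> i) (g ` e))))"
      by (intro sum.cong refl sum.swap)
    also have "\<dots> = (\<Sum>e\<in>E. \<Sum>i=1..r. \<Sum>g\<in>\<Psi>. \<sigma> * (w e * (a i * edge_energy (\<phi> i) (g ` e))))"
      by (rule sum.swap)
    also have "\<dots> = (\<Sum>e\<in>E. \<sigma> * (w e * (\<Sum>i=1..r. a i * (\<Sum>g\<in>\<Psi>. edge_energy (\<phi> i) (g ` e)))))"
      by (simp add: sum_distrib_left)
    also have "\<dots> = (\<Sum>e\<in>E. \<sigma> * (w e * (card \<Psi> * c)))"
      by (intro sum.cong refl) (simp only: orbit_balance_imp_edge_balance[OF simple \<Psi> Os balance])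
    also have "\<dots> = \<sigma> * (\<Sum>e\<in>E. w e) * (card \<Psi> * c)"
      by (simp add: sum_distrib_left sum_distrib_right mult_ac)
    finally show ?thesis using that by (simp add: normalized_weight_def mult_ac)
  qed
  have "\<sigma> * card \<Psi> * c * card E = (\<Sum>i=1..r. a i * X (\<lambda>_. 1) i)"
    by (rule total[symmetric]) (simp add: normalized_weight_def)
  also have "\<dots> = (\<Sum>i=1..r. a i * (card \<Psi> * m))"
    using \<phi> by (intro sum.cong refl) (auto simp: X_def dirichlet_form_permute_vec[OF simple \<Psi>])
  also have "\<dots> = card \<Psi> * m"
    using a by (simp flip: sum_distrib_right)
  finally have "(\<Sum>i=1..r. a i * X w i) = (\<Sum>i=1..r. a i) * (card \<Psi> * m)"
    using total[OF w] a by simp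
  then have zero: "(\<Sum>i=1..r. a i * (X w i - card \<Psi> * m)) = 0"
    by (simp add: right_diff_distrib sum_subtractf sum_distrib_right)
  have gap: "X w i - card \<Psi> * m > 0" if i: "i \<in> {1..r}" for i
  proof -
    have "(\<Sum>g\<in>\<Psi>. m) < X w i"
      unfolding X_def using contra card \<phi>[OF i] S Aut_subgroup(1)[OF \<Psi>]
      by (intro sum_strict_mono) (auto simp: card_gt_0_iff not_le)
    then show ?thesis by simp
  qed
  have nonneg: "0 \<le> a i * (X w i - card \<Psi> * m)" if "i \<in> {1..r}" for i
    using gap[OF that] \<phi>[OF that] by (intro mult_nonneg_nonneg) auto
  have "a i * (X w i - card \<Psi> * m) = 0" if "i \<in> {1..r}" for i
    using sum_nonneg_eq_0_iff[of "{1..r}" "\<lambda>i. a i * (X w i - card \<Psi> * m)"] nonneg zero that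
    by simp
  then have "a i = 0" if "i \<in> {1..r}" for i
    using gap[OF that] that by (metis less_irrefl mult_eq_0_iff)
  with a show False by simp
qed

text \<open>
  The conditions on \<open>\<sigma>\<close> say that it is a sign and that the extremal eigenvalue \<open>\<sigma> * m\<close> is positive; the
  constant of the forward direction is this eigenvalue divided by the number of edges.
\<close>

lemma extremal_rigidity_iff:
  fixes E :: "'v::finite set set" and S :: "(real^'v) set" and \<sigma> m :: real
  assumes simple: "simple_graph E" and E: "E \<noteq> {}" and \<Psi>: "subgroup \<Psi> (Aut_group E)"
    and Os: "bij_betw Os {1..s} (edge_orbits E \<Psi>)"
    and S: "compact S" "\<And>g \<phi>. bij g \<Longrightarrow> \<phi> \<in> S \<Longrightarrow> permute_vec g \<phi> \<in> S"
    and min: "\<And>\<phi>. \<phi> \<in> S \<Longrightarrow> m \<le> \<sigma> * dirichlet_form E (\<lambda>_. 1) \<phi>"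
    and \<sigma>: "\<sigma> * \<sigma> = 1" "\<sigma> * m > 0"
  shows "(\<forall>w. normalized_weight E w \<longrightarrow> (\<exists>\<phi>\<in>S. \<sigma> * dirichlet_form E w \<phi> \<le> m)) \<longleftrightarrow>
    (\<exists>(r::nat) \<phi> a (c::real).
       (\<forall>i\<in>{1..r}. (\<phi> i \<in> S \<and> \<sigma> * dirichlet_form E (\<lambda>_. 1) (\<phi> i) = m) \<and> a i \<ge> 0)
       \<and> (\<Sum>i=1..r. a i) = 1 \<and> c > 0
       \<and> (\<forall>j\<in>{1..s}. c * real (card (Os j)) = (\<Sum>i=1..r. a i * orbit_energy Os (\<phi> i) j)))"
    (is "?rigid \<longleftrightarrow> ?balance")
proof
  assume ?rigid
  then obtain r :: nat and \<phi> a where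
    \<phi>: "\<forall>i\<in>{1..r}. \<phi> i \<in> S \<and> \<sigma> * dirichlet_form E (\<lambda>_. 1) (\<phi> i) = m \<and> a i \<ge> 0"
    and a: "(\<Sum>i=1..r. a i) = 1"
    and edge: "\<forall>e\<in>E. m / card E = (\<Sum>i=1..r. a i * (\<sigma> * edge_energy (\<phi> i) e))"
    using extremal_rigidity_imp_edge_balance[OF simple E S(1) min] by blast
  define c where "c = \<sigma> * m / card E"
  have "c > 0" using \<sigma>(2) E by (simp add: c_def card_gt_0_iff)
  moreover have "c * real (card (Os j)) = (\<Sum>i=1..r. a i * orbit_energy Os (\<phi> i) j)"
    if "j \<in> {1..s}" for j
  proof -
    have "Os j \<in> edge_orbits E \<Psi>"
      using Os that by (auto simp: bij_betw_def)
    then have sub: "Os j \<subseteq> E"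
      using Aut_subgroup_edge[OF simple \<Psi>] by (auto simp: edge_orbits_eq)
    have "c = (\<Sum>i=1..r. a i * edge_energy (\<phi> i) e)" if "e \<in> Os j" for e
    proof -
      have e: "e \<in> E" using sub that by blast
      have "c = \<sigma> * (\<Sum>i=1..r. a i * (\<sigma> * edge_energy (\<phi> i) e))"
        unfolding c_def times_divide_eq_right[symmetric] edge[rule_format, OF e] by (rule refl)
      also have "\<dots> = (\<sigma> * \<sigma>) * (\<Sum>i=1..r. a i * edge_energy (\<phi> i) e)"
        by (simp add: sum_distrib_left mult_ac)
      finally show ?thesis by (simp add: \<sigma>(1))
    qed
    then have "(\<Sum>e\<in>Os j. c) = (\<Sum>e\<in>Os j. \<Sum>i=1..r. a i * edge_energy (\<phi> i) e)"
      by (intro sum.cong) auto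
    also have "\<dots> = (\<Sum>i=1..r. a i * orbit_energy Os (\<phi> i) j)"
      by (subst sum.swap) (simp add: orbit_energy_def sum_distrib_left)
    finally show ?thesis by (simp add: mult.commute)
  qed
  ultimately show ?balance
    using \<phi> a by (intro exI[of _ r] exI[of _ \<phi>] exI[of _ a] exI[of _ c]) auto
next
  assume ?balance
  then obtain r :: nat and \<phi> a c where
    "\<forall>i\<in>{1..r}. (\<phi> i \<in> S \<and> \<sigma> * dirichlet_form E (\<lambda>_. 1) (\<phi> i) = m) \<and> a i \<ge> 0"
    "(\<Sum>i=1..r. a i) = 1"
    "\<forall>j\<in>{1..s}. c * real (card (Os j)) = (\<Sum>i=1..r. a i * orbit_energy Os (\<phi> i) j)"
    by blast
  then show ?rigid
    using orbit_balance_imp_extremal_rigidity[OF simple \<Psi> Os S(2), of r \<phi> \<sigma> m a c] by auto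
qed

section \<open>The two spectral ends\<close>

text \<open>
  Since \<open>\<lambda>\<^sub>2\<close> differs from the eigenvalue 0 of the constants, its eigenvectors are orthogonal to the
  constants and hence test vectors; the converse is the first-order condition for minimizers.
\<close>

lemma second_eigenspace_iff:
  fixes E :: "'v::finite set set"
  assumes simple: "simple_graph E" and conn: "connected_graph E" and card: "CARD('v) \<ge> 2"
  defines "m \<equiv> lap_eigenvalue E (\<lambda>_. 1) 2"
  shows "\<phi> \<in> eigenspace (laplacian E (\<lambda>_. 1)) m \<and> norm \<phi> = 1 \<longleftrightarrow>
    (norm \<phi> = 1 \<and> 1 \<bullet> \<phi> = 0) \<and> dirichlet_form E (\<lambda>_. 1) \<phi> = m"
proof -
  let ?L = "laplacian E (\<lambda>_. 1)"
  have q: "\<psi> \<bullet> (?L *v \<psi>) = dirichlet_form E (\<lambda>_. 1) \<psi>" for \<psi>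
    by (simp add: laplacian_quadratic_form[OF simple] dirichlet_form_def)
  have one: "?L *v 1 = 0"
    by (rule laplacian_ones[OF simple]) simp
  have "m > 0"
    unfolding m_def by (rule second_laplacian_eigenvalue_pos[OF simple conn card])
  have "1 \<bullet> \<phi> = 0" if "\<phi> \<in> eigenspace ?L m"
    using eigenspaces_orthogonal[OF transpose_laplacian _ that, of 1 0] one \<open>m > 0\<close>
    by (simp add: eigenspace_def)
  moreover have "dirichlet_form E (\<lambda>_. 1) \<phi> = m" if "\<phi> \<in> eigenspace ?L m" "norm \<phi> = 1"
    using eigenvector_rayleigh[OF that] by (simp add: q)
  moreover have "\<phi> \<in> eigenspace ?L m"
    if "norm \<phi> = 1" "1 \<bullet> \<phi> = 0" "dirichlet_form E (\<lambda>_. 1) \<phi> = m"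
  proof (rule rayleigh_minimizer_in_eigenspace[OF transpose_laplacian subspace_hyperplane[of 1]])
    show "?L *v y \<in> {x. 1 \<bullet> x = 0}" for y
      using symmetric_matrix_inner[OF transpose_laplacian, of 1 E "\<lambda>_. 1" y] one by simp
    show "m * (y \<bullet> y) \<le> y \<bullet> (?L *v y)" if "y \<in> {x. 1 \<bullet> x = 0}" for y
      using second_laplacian_eigenvalue(2)[OF simple _ card]
      by (intro unit_lower_bound_homogeneous[OF subspace_hyperplane[of 1] that]) (simp add: m_def q)
  qed (use that in \<open>simp_all add: q dot_square_norm\<close>)
  ultimately show ?thesis by blast
qed

lemma last_eigenspace_iff:
  fixes E :: "'v::finite set set"
  assumes simple: "simple_graph E"
  defines "M \<equiv> lap_eigenvalue E (\<lambda>_. 1) CARD('v)"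
  shows "\<phi> \<in> eigenspace (laplacian E (\<lambda>_. 1)) M \<and> norm \<phi> = 1 \<longleftrightarrow>
    norm \<phi> = 1 \<and> dirichlet_form E (\<lambda>_. 1) \<phi> = M"
proof -
  let ?L = "laplacian E (\<lambda>_. 1)"
  have q: "\<psi> \<bullet> (?L *v \<psi>) = dirichlet_form E (\<lambda>_. 1) \<psi>" for \<psi>
    by (simp add: laplacian_quadratic_form[OF simple] dirichlet_form_def)
  have "dirichlet_form E (\<lambda>_. 1) \<phi> = M" if "\<phi> \<in> eigenspace ?L M" "norm \<phi> = 1"
    using eigenvector_rayleigh[OF that] by (simp add: q)
  moreover have "\<phi> \<in> eigenspace ?L M" if "norm \<phi> = 1" "dirichlet_form E (\<lambda>_. 1) \<phi> = M"
  proof -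
    have "\<phi> \<in> eigenspace (- ?L) (- M)"
    proof (rule rayleigh_minimizer_in_eigenspace[where U = UNIV])
      show "transpose (- ?L) = - ?L" by (simp add: transpose_minus transpose_laplacian)
      show "- M * (y \<bullet> y) \<le> y \<bullet> (- ?L *v y)" for y
        using last_laplacian_eigenvalue(2)[OF simple]
        by (intro unit_lower_bound_homogeneous[OF subspace_UNIV]) (auto simp: minus_matrix_vector_mult q M_def)
    qed (use that in \<open>simp_all add: minus_matrix_vector_mult q dot_square_norm\<close>)
    then show ?thesis by (simp add: eigenspace_def minus_matrix_vector_mult)
  qed
  ultimately show ?thesis by blast
qed

theorem theorem5p3:
  fixes E :: "'v::finite set set"
    and \<Psi> :: "('v \<Rightarrow> 'v) set"
    and Os :: "nat \<Rightarrow> 'v set set"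
    and s :: nat
  assumes "CARD('v) \<ge> 2"
    and "simple_graph E"
    and "connected_graph E"
    and "subgroup \<Psi> (Aut_group E)"
    and "bij_betw Os {1..s} (edge_orbits E \<Psi>)"
  shows "(lower_conformally_rigid E \<longleftrightarrow>
            (\<exists>(r::nat) (\<phi> :: nat \<Rightarrow> real^'v) (a :: nat \<Rightarrow> real) (c::real).
               (\<forall>i\<in>{1..r}. \<phi> i \<in> eigenspace (laplacian E (\<lambda>_. 1)) (lap_eigenvalue E (\<lambda>_. 1) 2)
                            \<and> norm (\<phi> i) = 1 \<and> a i \<ge> 0)
               \<and> (\<Sum>i=1..r. a i) = 1 \<and> c > 0
               \<and> (\<forall>j\<in>{1..s}. c * real (card (Os j)) = (\<Sum>i=1..r. a i * orbit_energy Os (\<phi> i) j))))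
       \<and> (upper_conformally_rigid E \<longleftrightarrow>
            (\<exists>(r::nat) (\<phi> :: nat \<Rightarrow> real^'v) (a :: nat \<Rightarrow> real) (c::real).
               (\<forall>i\<in>{1..r}. \<phi> i \<in> eigenspace (laplacian E (\<lambda>_. 1)) (lap_eigenvalue E (\<lambda>_. 1) CARD('v))
                            \<and> norm (\<phi> i) = 1 \<and> a i \<ge> 0)
               \<and> (\<Sum>i=1..r. a i) = 1 \<and> c > 0
               \<and> (\<forall>j\<in>{1..s}. c * real (card (Os j)) = (\<Sum>i=1..r. a i * orbit_energy Os (\<phi> i) j))))"
proof (rule conjI)
  note card = assms(1) and simple = assms(2) and conn = assms(3)
  let ?l = "lap_eigenvalue E (\<lambda>_. 1) 2" and ?u = "lap_eigenvalue E (\<lambda>_. 1) CARD('v)"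
  define S where "S = {\<phi> :: real^'v. norm \<phi> = 1 \<and> 1 \<bullet> \<phi> = 0}"
  have nonneg: "\<forall>e\<in>E. (0::real) \<le> 1" by simp
  have l_pos: "?l > 0"
    by (rule second_laplacian_eigenvalue_pos[OF simple conn card])
  obtain \<phi> :: "real^'v" where \<phi>: "norm \<phi> = 1" "dirichlet_form E (\<lambda>_. 1) \<phi> = ?l"
    using second_laplacian_eigenvalue(1)[OF simple nonneg card] by blast
  have u_pos: "?u > 0"
    using last_laplacian_eigenvalue(2)[OF simple \<phi>(1), where w = "\<lambda>_. 1"] \<phi>(2) l_pos by simp
  have E: "E \<noteq> {}"
    using \<phi>(2) l_pos by (auto simp: dirichlet_form_def)
  have "S = sphere 0 1 \<inter> {x. 1 \<bullet> x = 0}" by (auto simp: S_def)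
  then have S: "compact S"
    by (simp add: compact_Int_closed closed_hyperplane)
  (* the factors 1 and - 1 below are the sign \<sigma> of extremal_rigidity_iff *)
  have lower: "lower_conformally_rigid E \<longleftrightarrow>
      (\<forall>w. normalized_weight E w \<longrightarrow> (\<exists>\<phi>\<in>S. 1 * dirichlet_form E w \<phi> \<le> ?l))"
    unfolding lower_conformally_rigid_def
  proof (intro all_cong)
    fix w assume "normalized_weight E w"
    then have "\<forall>e\<in>E. 0 \<le> w e" by (simp add: normalized_weight_def)
    note second = second_laplacian_eigenvalue[OF simple this card]
    show "lap_eigenvalue E w 2 \<le> ?l \<longleftrightarrow> (\<exists>\<phi>\<in>S. 1 * dirichlet_form E w \<phi> \<le> ?l)"
      using second(1) second(2) by (fastforce simp: S_def)
  qed
  show "lower_conformally_rigid E \<longleftrightarrow>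
            (\<exists>(r::nat) (\<phi> :: nat \<Rightarrow> real^'v) (a :: nat \<Rightarrow> real) (c::real).
               (\<forall>i\<in>{1..r}. \<phi> i \<in> eigenspace (laplacian E (\<lambda>_. 1)) ?l \<and> norm (\<phi> i) = 1 \<and> a i \<ge> 0)
               \<and> (\<Sum>i=1..r. a i) = 1 \<and> c > 0
               \<and> (\<forall>j\<in>{1..s}. c * real (card (Os j)) = (\<Sum>i=1..r. a i * orbit_energy Os (\<phi> i) j)))"
    unfolding lower conj_assoc[symmetric] second_eigenspace_iff[OF simple conn card]
    using second_laplacian_eigenvalue(2)[OF simple _ card]
    by (subst extremal_rigidity_iff[OF simple E assms(4,5) S])
      (use l_pos in \<open>auto simp: S_def norm_permute_vec inner_ones_permute_vec conj_assoc\<close>)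
  have upper: "upper_conformally_rigid E \<longleftrightarrow>
      (\<forall>w. normalized_weight E w \<longrightarrow> (\<exists>\<phi>\<in>sphere 0 1. - 1 * dirichlet_form E w \<phi> \<le> - ?u))"
    unfolding upper_conformally_rigid_def
  proof (intro all_cong)
    fix w assume "normalized_weight E w"
    note last = last_laplacian_eigenvalue[OF simple, where w = w]
    show "?u \<le> lap_eigenvalue E w CARD('v) \<longleftrightarrow>
        (\<exists>\<phi>\<in>sphere 0 1. - 1 * dirichlet_form E w \<phi> \<le> - ?u)"
    proof
      assume "?u \<le> lap_eigenvalue E w CARD('v)"
      moreover obtain \<psi> where "norm \<psi> = 1" "dirichlet_form E w \<psi> = lap_eigenvalue E w CARD('v)"
        using last(1) by blast
      ultimately show "\<exists>\<phi>\<in>sphere 0 1. - 1 * dirichlet_form E w \<phi> \<le> - ?u"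
        by (intro bexI[of _ \<psi>]) auto
    next
      assume "\<exists>\<phi>\<in>sphere 0 1. - 1 * dirichlet_form E w \<phi> \<le> - ?u"
      then obtain \<psi> where "norm \<psi> = 1" "?u \<le> dirichlet_form E w \<psi>"
        by auto
      with last(2)[of \<psi>] show "?u \<le> lap_eigenvalue E w CARD('v)"
        by simp
    qed
  qed
  show "upper_conformally_rigid E \<longleftrightarrow>
            (\<exists>(r::nat) (\<phi> :: nat \<Rightarrow> real^'v) (a :: nat \<Rightarrow> real) (c::real).
               (\<forall>i\<in>{1..r}. \<phi> i \<in> eigenspace (laplacian E (\<lambda>_. 1)) ?u \<and> norm (\<phi> i) = 1 \<and> a i \<ge> 0)
               \<and> (\<Sum>i=1..r. a i) = 1 \<and> c > 0
               \<and> (\<forall>j\<in>{1..s}. c * real (card (Os j)) = (\<Sum>i=1..r. a i * orbit_energy Os (\<phi> i) j)))"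
    unfolding upper conj_assoc[symmetric] last_eigenspace_iff[OF simple]
    using last_laplacian_eigenvalue(2)[OF simple, where w = "\<lambda>_. 1"]
    by (subst extremal_rigidity_iff[OF simple E assms(4,5) compact_sphere])
      (use u_pos in \<open>auto simp: norm_permute_vec\<close>)
qed

end
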